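(* Let $\Bbbk$ be a commutative ring. Let $A$ be a (unital) Gerstenhaber algebra over $\Bbbk$ equipped with a linear operator $\Delta:A\to A$ of degree $1$ such that $\Delta\circ\Delta=0$. For $a\in A$ let $l_a:A\to A$, $l_a(b)=ab$, be left multiplication by $a$. For endomorphisms $f,g:A\to A$ let $[f,g]=f\circ g-(-1)^{|f||g|}g\circ f$ be the graded commutator. Then $A$ (with $\Delta$) is a Batalin-Vilkovisky algebra if and only if $$l_{\{a,b\}}=-[[l_a,\Delta],l_b]\ \text{ for all } a,b\in A,\quad\text{and}\quad \Delta(1)=0.$$
   Context: A Gerstenhaber algebra is a commutative graded (associative) algebra $A$ with a linear map $\{-,-\}:A_i\otimes A_j\to A_{i+j+1}$ such that for all homogeneous $a,b,c$: $\{a,b\}=-(-1)^{(|a|+1)(|b|+1)}\{b,a\}$; $\{a,\{b,c\}\}=\{\{a,b\},c\}+(-1)^{(|a|+1)(|b|+1)}\{b,\{a,c\}\}$; $\{a,bc\}=\{a,b\}c+(-1)^{(|a|+1)|b|}b\{a,c\}$. A Batalin-Vilkovisky algebra is a Gerstenhaber algebra $A$ equipped with a degree $1$ linear map $\Delta:A_i\to A_{i+1}$ such that $\Delta\circ\Delta=0$ and, for all $a,b\in A$, $\{a,b\}=(-1)^{|a|}\left(\Delta(ab)-(\Delta a)b-(-1)^{|a|}a(\Delta b)\right)$. *)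

theory Defs
  imports "HOL-Algebra.Algebra"
begin

(* Multiplication by (-1)^n in the additive group of A. *)
definition signed :: "('a, 'm) ring_scheme \<Rightarrow> int \<Rightarrow> 'a \<Rightarrow> 'a" where
  "signed A n x = (if even n then x else \<ominus>\<^bsub>A\<^esub> x)"

(* Unital Z-graded algebras over a commutative ring R, graded internally: the homogeneous
   component of degree i is the submodule G i of A, and A is the direct sum of the G i.
   The locale "algebra" of the library is not applicable, since it makes A strictly
   commutative.  The zero ring is allowed both for R and for A. *)
locale graded_algebra = module R A + ring A for R (structure) and A (structure) +
  fixes G :: "int \<Rightarrow> 'c set"
  assumes smult_mult_left:
      "\<lbrakk>r \<in> carrier R; x \<in> carrier A; y \<in> carrier A\<rbrakk> \<Longrightarrow>
        (r \<odot>\<^bsub>A\<^esub> x) \<otimes>\<^bsub>A\<^esub> y = r \<odot>\<^bsub>A\<^esub> (x \<otimes>\<^bsub>A\<^esub> y)"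
    and smult_mult_right:
      "\<lbrakk>r \<in> carrier R; x \<in> carrier A; y \<in> carrier A\<rbrakk> \<Longrightarrow>
        x \<otimes>\<^bsub>A\<^esub> (r \<odot>\<^bsub>A\<^esub> y) = r \<odot>\<^bsub>A\<^esub> (x \<otimes>\<^bsub>A\<^esub> y)"
    and component_submodule: "submodule (G i) R A"
    and direct_sum: "x \<in> carrier A \<Longrightarrow>
        \<exists>!h. (\<forall>i. h i \<in> G i) \<and> finite {i. h i \<noteq> \<zero>\<^bsub>A\<^esub>} \<and>
             x = (\<Oplus>\<^bsub>A\<^esub>i\<in>{i. h i \<noteq> \<zero>\<^bsub>A\<^esub>}. h i)"
    and one_degree: "\<one>\<^bsub>A\<^esub> \<in> G 0"
    and mult_degree: "\<lbrakk>x \<in> G i; y \<in> G j\<rbrakk> \<Longrightarrow> x \<otimes>\<^bsub>A\<^esub> y \<in> G (i + j)"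

locale graded_commutative_algebra = graded_algebra +
  assumes graded_comm:
    "\<lbrakk>x \<in> G i; y \<in> G j\<rbrakk> \<Longrightarrow> x \<otimes>\<^bsub>A\<^esub> y = signed A (i * j) (y \<otimes>\<^bsub>A\<^esub> x)"

definition linear_endo ::
  "('k, 'n) ring_scheme \<Rightarrow> ('k, 'a, 'm) module_scheme \<Rightarrow> ('a \<Rightarrow> 'a) \<Rightarrow> bool" where
  "linear_endo R A f \<longleftrightarrow>
     f \<in> carrier A \<rightarrow> carrier A \<and>
     (\<forall>x\<in>carrier A. \<forall>y\<in>carrier A. f (x \<oplus>\<^bsub>A\<^esub> y) = f x \<oplus>\<^bsub>A\<^esub> f y) \<and>
     (\<forall>r\<in>carrier R. \<forall>x\<in>carrier A. f (r \<odot>\<^bsub>A\<^esub> x) = r \<odot>\<^bsub>A\<^esub> f x)"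

definition has_degree :: "(int \<Rightarrow> 'a set) \<Rightarrow> int \<Rightarrow> ('a \<Rightarrow> 'a) \<Rightarrow> bool" where
  "has_degree G d f \<longleftrightarrow> (\<forall>i. f ` G i \<subseteq> G (i + d))"

(* The bracket is given on all of A by bilinearity; its signed identities are only
   meaningful, and only required, on homogeneous elements. *)
locale gerstenhaber_algebra = graded_commutative_algebra +
  fixes br :: "'c \<Rightarrow> 'c \<Rightarrow> 'c"
  assumes bracket_linear_right: "a \<in> carrier A \<Longrightarrow> linear_endo R A (\<lambda>b. br a b)"
    and bracket_linear_left: "b \<in> carrier A \<Longrightarrow> linear_endo R A (\<lambda>a. br a b)"
    and bracket_degree: "\<lbrakk>a \<in> G i; b \<in> G j\<rbrakk> \<Longrightarrow> br a b \<in> G (i + j + 1)"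
    and bracket_antisym:
      "\<lbrakk>a \<in> G i; b \<in> G j\<rbrakk> \<Longrightarrow> br a b = \<ominus>\<^bsub>A\<^esub> signed A ((i + 1) * (j + 1)) (br b a)"
    and bracket_jacobi:
      "\<lbrakk>a \<in> G i; b \<in> G j; c \<in> G k\<rbrakk> \<Longrightarrow>
        br a (br b c) = br (br a b) c \<oplus>\<^bsub>A\<^esub> signed A ((i + 1) * (j + 1)) (br b (br a c))"
    and bracket_poisson:
      "\<lbrakk>a \<in> G i; b \<in> G j; c \<in> G k\<rbrakk> \<Longrightarrow>
        br a (b \<otimes>\<^bsub>A\<^esub> c) = br a b \<otimes>\<^bsub>A\<^esub> c \<oplus>\<^bsub>A\<^esub> signed A ((i + 1) * j) (b \<otimes>\<^bsub>A\<^esub> br a c)"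

locale batalin_vilkovisky_algebra = gerstenhaber_algebra +
  fixes \<Delta> :: "'c \<Rightarrow> 'c"
  assumes Delta_linear: "linear_endo R A \<Delta>"
    and Delta_degree: "has_degree G 1 \<Delta>"
    and Delta_square: "x \<in> carrier A \<Longrightarrow> \<Delta> (\<Delta> x) = \<zero>\<^bsub>A\<^esub>"
    and Delta_bracket:
      "\<lbrakk>a \<in> G i; b \<in> G j\<rbrakk> \<Longrightarrow>
        br a b = signed A i
          ((\<Delta> (a \<otimes>\<^bsub>A\<^esub> b) \<ominus>\<^bsub>A\<^esub> \<Delta> a \<otimes>\<^bsub>A\<^esub> b) \<ominus>\<^bsub>A\<^esub> signed A i (a \<otimes>\<^bsub>A\<^esub> \<Delta> b))"

(* The endomorphisms below are restricted to the carrier, so that HOL equality between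
   them is equality of maps A -> A. *)

definition left_mult :: "('a, 'm) ring_scheme \<Rightarrow> 'a \<Rightarrow> 'a \<Rightarrow> 'a" where
  "left_mult A a = (\<lambda>x\<in>carrier A. a \<otimes>\<^bsub>A\<^esub> x)"

definition endo_neg :: "('a, 'm) ring_scheme \<Rightarrow> ('a \<Rightarrow> 'a) \<Rightarrow> 'a \<Rightarrow> 'a" where
  "endo_neg A f = (\<lambda>x\<in>carrier A. \<ominus>\<^bsub>A\<^esub> f x)"

(* The graded commutator of f, of degree p, and g, of degree q.  The degrees are arguments
   because the zero map has every degree. *)
definition graded_commutator ::
  "('a, 'm) ring_scheme \<Rightarrow> int \<Rightarrow> int \<Rightarrow> ('a \<Rightarrow> 'a) \<Rightarrow> ('a \<Rightarrow> 'a) \<Rightarrow> 'a \<Rightarrow> 'a" where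
  "graded_commutator A p q f g =
     (\<lambda>x\<in>carrier A. (f \<circ> g) x \<ominus>\<^bsub>A\<^esub> signed A (p * q) ((g \<circ> f) x))"

end

theory Submission
  imports Defs
begin

text \<open>
  For homogeneous \<open>a\<close>, \<open>b\<close> put \<open>\<Phi>(a, b) = \<Delta>(ab) - (\<Delta>a)b - (-1)\<^sup>|\<^sup>a\<^sup>| a\<Delta>b\<close>.  Evaluating
  \<open>-[[l\<^sub>a, \<Delta>], l\<^sub>b]\<close> at \<open>1\<close> with \<open>\<Delta>(1) = 0\<close> gives \<open>(-1)\<^sup>|\<^sup>a\<^sup>| \<Phi>(a, b)\<close> by graded commutativity.
  Conversely, in a BV algebra the Poisson rule gives \<open>{a, 1} = 0\<close>, hence \<open>\<Delta>(1) = -{1, 1} = 0\<close>, and it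
  expresses \<open>{a, b}x\<close> as \<open>{a, bx} - (-1)\<^bsup>(|a|+1)|b|\<^esup> b{a, x}\<close>; inserting the BV formula, the two terms
  containing \<open>\<Delta>a\<close> cancel and what is left is \<open>-[[l\<^sub>a, \<Delta>], l\<^sub>b](x)\<close> for homogeneous \<open>x\<close>.
\<close>

lemma (in graded_algebra) component_closed: "x \<in> G i \<Longrightarrow> x \<in> carrier A"
  using component_submodule[of i] by (auto simp: submodule_def subgroup_def)

lemma (in ring) signed_closed [simp]: "x \<in> carrier R \<Longrightarrow> signed R n x \<in> carrier R"
  by (simp add: signed_def)

lemma (in ring) signed_add:
  "\<lbrakk>x \<in> carrier R; y \<in> carrier R\<rbrakk> \<Longrightarrow> signed R n (x \<oplus> y) = signed R n x \<oplus> signed R n y"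
  by (simp add: signed_def minus_add)

lemma (in ring) additive_zero:
  assumes "f \<in> carrier R \<rightarrow> carrier R"
    and "\<And>x y. \<lbrakk>x \<in> carrier R; y \<in> carrier R\<rbrakk> \<Longrightarrow> f (x \<oplus> y) = f x \<oplus> f y"
  shows "f \<zero> = \<zero>"
proof -
  have c: "f \<zero> \<in> carrier R" using assms(1) by auto
  have "f \<zero> \<oplus> f \<zero> = f \<zero>" using assms(2)[of \<zero> \<zero>] by simp
  then show ?thesis using c by (metis add.r_cancel_one)
qed

text \<open>Every element is a finite sum of homogeneous ones, so induction over the set of summands
  suffices. This carries identities whose signs require a homogeneous argument over to all of
  \<open>A\<close>.\<close>

lemma (in graded_algebra) additive_eqI:
  assumes f: "f \<in> carrier A \<rightarrow> carrier A"
    "\<And>x y. \<lbrakk>x \<in> carrier A; y \<in> carrier A\<rbrakk> \<Longrightarrow> f (x \<oplus>\<^bsub>A\<^esub> y) = f x \<oplus>\<^bsub>A\<^esub> f y"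
    and g: "g \<in> carrier A \<rightarrow> carrier A"
    "\<And>x y. \<lbrakk>x \<in> carrier A; y \<in> carrier A\<rbrakk> \<Longrightarrow> g (x \<oplus>\<^bsub>A\<^esub> y) = g x \<oplus>\<^bsub>A\<^esub> g y"
    and homogeneous: "\<And>i x. x \<in> G i \<Longrightarrow> f x = g x"
    and x: "x \<in> carrier A"
  shows "f x = g x"
proof -
  obtain h where h: "\<And>i. h i \<in> G i" "finite {i. h i \<noteq> \<zero>\<^bsub>A\<^esub>}"
    "x = (\<Oplus>\<^bsub>A\<^esub>i\<in>{i. h i \<noteq> \<zero>\<^bsub>A\<^esub>}. h i)"
    using direct_sum[OF x] by blast
  have hc: "h i \<in> carrier A" for i using h(1) component_closed by blast
  have "f (\<Oplus>\<^bsub>A\<^esub>i\<in>S. h i) = g (\<Oplus>\<^bsub>A\<^esub>i\<in>S. h i)" if "finite S" for S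
    using that
  proof (induction S)
    case empty
    show ?case
      using additive_zero[OF f] additive_zero[OF g] by simp
  next
    case (insert i S)
    then show ?case
      using hc homogeneous[OF h(1)] by (simp add: f(2) g(2) Pi_I)
  qed
  with h show ?thesis by blast
qed

text \<open>Common ground for both sides of the equivalence: the operator is not yet related to the
  bracket.\<close>

locale gerstenhaber_algebra_operator = gerstenhaber_algebra +
  fixes \<Delta> :: "'c \<Rightarrow> 'c"
  assumes Delta_linear: "linear_endo R A \<Delta>"
    and Delta_degree: "has_degree G 1 \<Delta>"
begin

lemma Delta_closed [simp]: "x \<in> carrier A \<Longrightarrow> \<Delta> x \<in> carrier A"
  using Delta_linear by (auto simp: linear_endo_def)

lemma Delta_add: "\<lbrakk>x \<in> carrier A; y \<in> carrier A\<rbrakk> \<Longrightarrow> \<Delta> (x \<oplus>\<^bsub>A\<^esub> y) = \<Delta> x \<oplus>\<^bsub>A\<^esub> \<Delta> y"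
  using Delta_linear by (auto simp: linear_endo_def)

lemma Delta_component: "x \<in> G i \<Longrightarrow> \<Delta> x \<in> G (i + 1)"
  using Delta_degree by (auto simp: has_degree_def)

lemma bracket_closed: "\<lbrakk>a \<in> carrier A; b \<in> carrier A\<rbrakk> \<Longrightarrow> br a b \<in> carrier A"
  using bracket_linear_right[of a] by (auto simp: linear_endo_def)

text \<open>The signed defect of \<Delta> from being a derivation. The degree \<open>i\<close> of
  \<open>a\<close> is an argument because zero lies in every component; \<open>b\<close> may be
  inhomogeneous.\<close>

definition bv_bracket :: "int \<Rightarrow> 'c \<Rightarrow> 'c \<Rightarrow> 'c" where
  "bv_bracket i a b = signed A i
     ((\<Delta> (a \<otimes>\<^bsub>A\<^esub> b) \<ominus>\<^bsub>A\<^esub> \<Delta> a \<otimes>\<^bsub>A\<^esub> b) \<ominus>\<^bsub>A\<^esub> signed A i (a \<otimes>\<^bsub>A\<^esub> \<Delta> b))"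

definition commutator_operator :: "int \<Rightarrow> int \<Rightarrow> 'c \<Rightarrow> 'c \<Rightarrow> 'c \<Rightarrow> 'c" where
  "commutator_operator i j a b =
     endo_neg A (graded_commutator A (i + 1) j
       (graded_commutator A i 1 (left_mult A a) \<Delta>) (left_mult A b))"

lemma commutator_operator_apply:
  assumes "a \<in> carrier A" "b \<in> carrier A" "x \<in> carrier A"
  shows "commutator_operator i j a b x =
    (signed A i (\<Delta> (a \<otimes>\<^bsub>A\<^esub> (b \<otimes>\<^bsub>A\<^esub> x))) \<ominus>\<^bsub>A\<^esub> a \<otimes>\<^bsub>A\<^esub> \<Delta> (b \<otimes>\<^bsub>A\<^esub> x)) \<oplus>\<^bsub>A\<^esub>
    (signed A ((i + 1) * j) (b \<otimes>\<^bsub>A\<^esub> (a \<otimes>\<^bsub>A\<^esub> \<Delta> x)) \<ominus>\<^bsub>A\<^esub>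
     signed A ((i + 1) * j + i) (b \<otimes>\<^bsub>A\<^esub> \<Delta> (a \<otimes>\<^bsub>A\<^esub> x)))"
  using assms
  by (cases "even i"; cases "even j")
    (simp_all add: commutator_operator_def endo_neg_def graded_commutator_def left_mult_def
      signed_def a_minus_def minus_add r_distr r_minus a_ac)

lemma commutator_operator_add:
  assumes "a \<in> carrier A" "b \<in> carrier A" "x \<in> carrier A" "y \<in> carrier A"
  shows "commutator_operator i j a b (x \<oplus>\<^bsub>A\<^esub> y) =
    commutator_operator i j a b x \<oplus>\<^bsub>A\<^esub> commutator_operator i j a b y"
  using assms
  by (simp add: commutator_operator_apply Delta_add r_distr signed_add a_minus_def minus_add a_ac)

lemma commutator_operator_one:
  assumes "a \<in> G i" "b \<in> G j" and "\<Delta> \<one>\<^bsub>A\<^esub> = \<zero>\<^bsub>A\<^esub>"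
  shows "commutator_operator i j a b \<one>\<^bsub>A\<^esub> = bv_bracket i a b"
proof -
  have c: "a \<in> carrier A" "b \<in> carrier A" using assms component_closed by auto
  \<comment> \<open>At the unit the term with \<Delta>(1) vanishes, and this swap cancels the sign
    (i + 1)j of the last term.\<close>
  have "b \<otimes>\<^bsub>A\<^esub> \<Delta> a = signed A (j * (i + 1)) (\<Delta> a \<otimes>\<^bsub>A\<^esub> b)"
    using graded_comm[OF assms(2) Delta_component[OF assms(1)]] .
  with c assms(3) show ?thesis
    by (cases "even i"; cases "even j")
      (simp_all add: commutator_operator_apply bv_bracket_def signed_def a_minus_def minus_add a_ac)
qed

text \<open>This has the shape of the Poisson rule, with the commutator in the place of {a, b}x. It
  is a formal expansion once the \<Delta>a terms are matched.\<close>

lemma bv_bracket_commutator: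
  assumes "a \<in> G i" "b \<in> G j" "x \<in> carrier A"
  shows "bv_bracket i a (b \<otimes>\<^bsub>A\<^esub> x) =
    commutator_operator i j a b x \<oplus>\<^bsub>A\<^esub>
    signed A ((i + 1) * j) (b \<otimes>\<^bsub>A\<^esub> bv_bracket i a x)"
proof -
  have c: "a \<in> carrier A" "b \<in> carrier A" using assms component_closed by auto
  have comm: "\<Delta> a \<otimes>\<^bsub>A\<^esub> b = signed A ((i + 1) * j) (b \<otimes>\<^bsub>A\<^esub> \<Delta> a)"
    using graded_comm[OF Delta_component[OF assms(1)] assms(2)] .
  \<comment> \<open>Moving b to the left of \<Delta>a makes the \<Delta>a terms of the two
    \<open>bv_bracket\<close> values agree, including their signs.\<close>
  have "\<Delta> a \<otimes>\<^bsub>A\<^esub> (b \<otimes>\<^bsub>A\<^esub> x) = signed A ((i + 1) * j) (b \<otimes>\<^bsub>A\<^esub> \<Delta> a) \<otimes>\<^bsub>A\<^esub> x"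
    using c assms(3) by (simp flip: comm add: m_assoc)
  also have "\<dots> = signed A ((i + 1) * j) (b \<otimes>\<^bsub>A\<^esub> (\<Delta> a \<otimes>\<^bsub>A\<^esub> x))"
    using c assms(3) by (simp add: signed_def m_assoc l_minus)
  finally have Delta_a:
    "\<Delta> a \<otimes>\<^bsub>A\<^esub> (b \<otimes>\<^bsub>A\<^esub> x) = signed A ((i + 1) * j) (b \<otimes>\<^bsub>A\<^esub> (\<Delta> a \<otimes>\<^bsub>A\<^esub> x))" .
  have closed: "a \<otimes>\<^bsub>A\<^esub> \<Delta> (b \<otimes>\<^bsub>A\<^esub> x) \<in> carrier A" "\<Delta> (a \<otimes>\<^bsub>A\<^esub> (b \<otimes>\<^bsub>A\<^esub> x)) \<in> carrier A"
    "b \<otimes>\<^bsub>A\<^esub> (a \<otimes>\<^bsub>A\<^esub> \<Delta> x) \<in> carrier A" "b \<otimes>\<^bsub>A\<^esub> \<Delta> (a \<otimes>\<^bsub>A\<^esub> x) \<in> carrier A"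
    "b \<otimes>\<^bsub>A\<^esub> (\<Delta> a \<otimes>\<^bsub>A\<^esub> x) \<in> carrier A" "\<Delta> a \<in> carrier A" "\<Delta> x \<in> carrier A"
    "\<Delta> (a \<otimes>\<^bsub>A\<^esub> x) \<in> carrier A" "\<Delta> (b \<otimes>\<^bsub>A\<^esub> x) \<in> carrier A"
    using c assms(3) by simp_all
  show ?thesis
    unfolding commutator_operator_apply[OF c assms(3)] bv_bracket_def Delta_a
    using c assms(3) closed
    by (cases "even i"; cases "even j"; simp add: signed_def; algebra)
qed

text \<open>A graded derivation kills 1 = 1 * 1; the Poisson sign is trivial because 1 has degree
  0.\<close>

lemma bracket_one_right:
  assumes "a \<in> G i"
  shows "br a \<one>\<^bsub>A\<^esub> = \<zero>\<^bsub>A\<^esub>"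
proof -
  have c: "br a \<one>\<^bsub>A\<^esub> \<in> carrier A" using assms component_closed bracket_closed by simp
  have "br a \<one>\<^bsub>A\<^esub> = br a \<one>\<^bsub>A\<^esub> \<oplus>\<^bsub>A\<^esub> br a \<one>\<^bsub>A\<^esub>"
    using bracket_poisson[OF assms one_degree one_degree] c by (simp add: signed_def)
  with c show ?thesis by (metis add.r_cancel_one)
qed

lemma Delta_one:
  assumes bv: "\<And>i j a b. \<lbrakk>a \<in> G i; b \<in> G j\<rbrakk> \<Longrightarrow> br a b = bv_bracket i a b"
  shows "\<Delta> \<one>\<^bsub>A\<^esub> = \<zero>\<^bsub>A\<^esub>"
proof -
  have "\<zero>\<^bsub>A\<^esub> = bv_bracket 0 \<one>\<^bsub>A\<^esub> \<one>\<^bsub>A\<^esub>"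
    using bracket_one_right[OF one_degree] bv[OF one_degree one_degree] by simp
  \<comment> \<open>The three terms are \<Delta>(1) with signs +, -, -.\<close>
  also have "\<dots> = \<ominus>\<^bsub>A\<^esub> \<Delta> \<one>\<^bsub>A\<^esub>"
    by (simp add: bv_bracket_def signed_def a_minus_def r_neg)
  finally show ?thesis by (metis Delta_closed minus_minus minus_zero one_closed)
qed

text \<open>The Poisson rule and \<open>bv_bracket_commutator\<close> both split {a, by} with the
  same second summand, which cancels. Homogeneous y is treated first, since \<open>bv\<close>
  applies only when by and y are homogeneous.\<close>

lemma bracket_mult_eq_commutator:
  assumes bv: "\<And>i j a b. \<lbrakk>a \<in> G i; b \<in> G j\<rbrakk> \<Longrightarrow> br a b = bv_bracket i a b"
    and a: "a \<in> G i" and b: "b \<in> G j" and x: "x \<in> carrier A"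
  shows "br a b \<otimes>\<^bsub>A\<^esub> x = commutator_operator i j a b x"
proof (rule additive_eqI[OF _ _ _ _ _ x])
  have c: "a \<in> carrier A" "b \<in> carrier A" "br a b \<in> carrier A"
    using a b component_closed bracket_closed by auto
  show "(\<otimes>\<^bsub>A\<^esub>) (br a b) \<in> carrier A \<rightarrow> carrier A"
    "commutator_operator i j a b \<in> carrier A \<rightarrow> carrier A"
    using c by (auto simp: commutator_operator_apply)
  show "br a b \<otimes>\<^bsub>A\<^esub> (y \<oplus>\<^bsub>A\<^esub> z) = br a b \<otimes>\<^bsub>A\<^esub> y \<oplus>\<^bsub>A\<^esub> br a b \<otimes>\<^bsub>A\<^esub> z"
    "commutator_operator i j a b (y \<oplus>\<^bsub>A\<^esub> z) =
      commutator_operator i j a b y \<oplus>\<^bsub>A\<^esub> commutator_operator i j a b z"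
    if "y \<in> carrier A" "z \<in> carrier A" for y z
    using c that by (simp_all add: r_distr commutator_operator_add)
  show "br a b \<otimes>\<^bsub>A\<^esub> y = commutator_operator i j a b y" if y: "y \<in> G k" for k y
  proof -
    have yc: "y \<in> carrier A" using y component_closed by simp
    have "br a b \<otimes>\<^bsub>A\<^esub> y \<oplus>\<^bsub>A\<^esub> signed A ((i + 1) * j) (b \<otimes>\<^bsub>A\<^esub> br a y) =
      commutator_operator i j a b y \<oplus>\<^bsub>A\<^esub> signed A ((i + 1) * j) (b \<otimes>\<^bsub>A\<^esub> br a y)"
      using bracket_poisson[OF a b y] bv[OF a mult_degree[OF b y]]
        bv_bracket_commutator[OF a b yc] bv[OF a y] by simp
    then show ?thesis
      \<comment> \<open>The expansion shows that the commutator value lies in the carrier, as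
        cancellation requires.\<close>
      using c yc bracket_closed by (simp add: commutator_operator_apply)
  qed
qed

lemma left_mult_bracket_iff:
  assumes "a \<in> carrier A" "b \<in> carrier A"
  shows "left_mult A (br a b) = commutator_operator i j a b \<longleftrightarrow>
    (\<forall>x\<in>carrier A. br a b \<otimes>\<^bsub>A\<^esub> x = commutator_operator i j a b x)"
proof
  assume "left_mult A (br a b) = commutator_operator i j a b"
  then show "\<forall>x\<in>carrier A. br a b \<otimes>\<^bsub>A\<^esub> x = commutator_operator i j a b x"
    by (metis left_mult_def restrict_apply')
next
  assume "\<forall>x\<in>carrier A. br a b \<otimes>\<^bsub>A\<^esub> x = commutator_operator i j a b x"
  then show "left_mult A (br a b) = commutator_operator i j a b"
    \<comment> \<open>Off the carrier both restricted maps are \<open>undefined\<close>.\<close>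
    by (intro ext) (auto simp: left_mult_def commutator_operator_def endo_neg_def restrict_def)
qed

theorem bv_bracket_iff_commutator:
  "(\<forall>i j. \<forall>a\<in>G i. \<forall>b\<in>G j. br a b = bv_bracket i a b) \<longleftrightarrow>
   (\<forall>i j. \<forall>a\<in>G i. \<forall>b\<in>G j. left_mult A (br a b) = commutator_operator i j a b) \<and>
   \<Delta> \<one>\<^bsub>A\<^esub> = \<zero>\<^bsub>A\<^esub>" (is "?bv \<longleftrightarrow> ?comm \<and> ?one")
proof
  assume ?bv
  then have "\<And>i j a b. \<lbrakk>a \<in> G i; b \<in> G j\<rbrakk> \<Longrightarrow> br a b = bv_bracket i a b" by blast
  from Delta_one[OF this] bracket_mult_eq_commutator[OF this] show "?comm \<and> ?one"
    by (simp add: left_mult_bracket_iff component_closed)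
next
  assume *: "?comm \<and> ?one"
  show ?bv
  proof (intro allI ballI)
    fix i j a b
    assume ab: "a \<in> G i" "b \<in> G j"
    then have c: "a \<in> carrier A" "b \<in> carrier A" using component_closed by auto
    \<comment> \<open>Evaluation at the unit recovers an element from its left
      multiplication.\<close>
    have "br a b \<otimes>\<^bsub>A\<^esub> \<one>\<^bsub>A\<^esub> = commutator_operator i j a b \<one>\<^bsub>A\<^esub>"
      using * ab left_mult_bracket_iff[OF c] one_closed by blast
    then show "br a b = bv_bracket i a b"
      using * ab c bracket_closed by (simp add: commutator_operator_one)
  qed
qed

end

theorem proposition28:
  fixes R :: "('k, 'n) ring_scheme" and A :: "('k, 'a, 'm) module_scheme"
    and G :: "int \<Rightarrow> 'a set" and br :: "'a \<Rightarrow> 'a \<Rightarrow> 'a" and \<Delta> :: "'a \<Rightarrow> 'a"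
  assumes "gerstenhaber_algebra R A G br"
    and "linear_endo R A \<Delta>" and "has_degree G 1 \<Delta>"
    and "\<forall>x\<in>carrier A. \<Delta> (\<Delta> x) = \<zero>\<^bsub>A\<^esub>"
  shows "batalin_vilkovisky_algebra R A G br \<Delta> \<longleftrightarrow>
    (\<forall>i j. \<forall>a\<in>G i. \<forall>b\<in>G j.
       left_mult A (br a b) =
         endo_neg A (graded_commutator A (i + 1) j
           (graded_commutator A i 1 (left_mult A a) \<Delta>) (left_mult A b))) \<and>
    \<Delta> \<one>\<^bsub>A\<^esub> = \<zero>\<^bsub>A\<^esub>"
proof -
  interpret gerstenhaber_algebra_operator R A G br \<Delta>
    using assms(1-3)
    by (simp add: gerstenhaber_algebra_operator_def gerstenhaber_algebra_operator_axioms_def)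
  \<comment> \<open>Beyond the hypotheses, a BV structure demands exactly the bracket
    formula.\<close>
  have "batalin_vilkovisky_algebra R A G br \<Delta> \<longleftrightarrow>
    (\<forall>i j. \<forall>a\<in>G i. \<forall>b\<in>G j. br a b = bv_bracket i a b)"
    using assms
    unfolding batalin_vilkovisky_algebra_def batalin_vilkovisky_algebra_axioms_def bv_bracket_def
    by blast
  then show ?thesis
    using bv_bracket_iff_commutator unfolding commutator_operator_def by simp
qed


end
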